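(* Let $e\ge 3$ be an odd integer, $q=2^e$, and let $\mathcal{C}^3_\varepsilon:=\mathcal{C}(\mathcal{V}^3_\varepsilon)$ be the code over $\mathbb{F}_{q^2}$ generated by the point set $\mathcal{V}^3_\varepsilon\subset\mathrm{PG}(3,q^2)$ (defined in the context, with $r=3$). Then $\mathcal{C}^3_\varepsilon$ is a minimal linear code if and only if $e\equiv 3\pmod 4$.
   Context: Let $e\ge 3$ be odd, $q=2^e$, $r\ge 2$. Points of $\mathrm{PG}(r,q^2)$ (projective space of projective dimension $r$ over $\mathbb{F}_{q^2}$) have homogeneous coordinates $(X_0,\dots,X_r)$; $\Pi_\infty$ is the hyperplane $X_0=0$, and affine coordinates on the complement $\mathrm{AG}(r,q^2)$ are $x_i=X_i/X_0$. For an exponent involving $\sigma$, $\sigma$ stands for $2^{(e+1)/2}$, i.e. $x^{\sigma}=x^{2^{(e+1)/2}}$ and $x^{\sigma+2}=x^{2^{(e+1)/2}+2}$. Fix $\varepsilon\in\mathbb{F}_{q^2}\setminus\mathbb{F}_q$ such that $\varepsilon^2+\varepsilon+\delta=0$ for some $\delta\in\mathbb{F}_q\setminus\{1\}$ with absolute trace $\mathrm{Tr}_{q/2}(\delta)=\sum_{i=0}^{e-1}\delta^{2^i}=1$. Put $$\Gamma_{\varepsilon}(x)=[x+(x^q+x)\varepsilon]^{\sigma+2}+(x^q+x)^{\sigma}+(x^{2q}+x^2)\varepsilon+x^{q+1}+x^2.$$ $\mathcal{V}^r_\varepsilon$ is the projective hypersurface of $\mathrm{PG}(r,q^2)$ with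 affine equation $x_r^q+x_r=\Gamma_{\varepsilon}(x_1)+\dots+\Gamma_{\varepsilon}(x_{r-1})$, i.e. the zero locus of the homogenization (with respect to $X_0$) of the corresponding polynomial; it is identified with its set of $\mathbb{F}_{q^2}$-rational points. For a set $\Omega$ of $N$ points of $\mathrm{PG}(r,q^2)$, $\mathcal{C}(\Omega)$ is the linear code of length $N$ over $\mathbb{F}_{q^2}$ spanned by the rows of an $(r+1)\times N$ matrix whose columns are coordinate vectors of the points of $\Omega$ (one representative per point); it is unique up to monomial equivalence. The support of a codeword $c=(c_1,\dots,c_N)$ is $\mathrm{supp}(c)=\{i: c_i\ne 0\}$. A codeword $c\in\mathcal{C}$ is minimal if every non-zero codeword $c'\in\mathcal{C}$ with $\mathrm{supp}(c')\subseteq\mathrm{supp}(c)$ is a scalar multiple of $c$. A linear code is minimal if all its non-zero codewords are minimal. *)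

theory Defs
  imports
    "HOL-Library.Poly_Mapping"
    "HOL-Number_Theory.Cong"
    "Jordan_Normal_Form.VS_Connect"
begin

section \<open>Multivariate polynomials\<close>

text \<open>
  A monomial is a finitely supported exponent function, and a polynomial is a finitely supported
  function from monomials to coefficients; the ring structure on polynomials is that of
  \<^theory>\<open>HOL-Library.Poly_Mapping\<close>.  The variable with index \<open>i\<close> is the coordinate \<open>X\<^sub>i\<close>.
\<close>

type_synonym 'a mpoly = "(nat \<Rightarrow>\<^sub>0 nat) \<Rightarrow>\<^sub>0 'a"

definition mconst :: "'a::comm_ring_1 \<Rightarrow> 'a mpoly" where
  "mconst c = Poly_Mapping.single 0 c"

definition mvar :: "nat \<Rightarrow> 'a::comm_ring_1 mpoly" where
  "mvar i = Poly_Mapping.single (Poly_Mapping.single i 1) 1"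

definition mon_degree :: "(nat \<Rightarrow>\<^sub>0 nat) \<Rightarrow> nat" where
  "mon_degree m = (\<Sum>i\<in>Poly_Mapping.keys m. Poly_Mapping.lookup m i)"

definition total_degree :: "'a::comm_ring_1 mpoly \<Rightarrow> nat" where
  "total_degree p = Max (insert 0 (mon_degree ` Poly_Mapping.keys p))"

definition meval :: "(nat \<Rightarrow> 'a::comm_ring_1) \<Rightarrow> 'a mpoly \<Rightarrow> 'a" where
  "meval x p = (\<Sum>m\<in>Poly_Mapping.keys p. Poly_Mapping.lookup p m *
     (\<Prod>i\<in>Poly_Mapping.keys m. x i ^ Poly_Mapping.lookup m i))"

text \<open>
  Homogenization with respect to \<open>X\<^sub>0\<close>, for polynomials in which \<open>X\<^sub>0\<close> does not occur: the
  affine coordinate \<open>x\<^sub>i = X\<^sub>i / X\<^sub>0\<close> is represented by the same variable \<open>X\<^sub>i\<close>.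
\<close>

definition homogenize :: "'a::comm_ring_1 mpoly \<Rightarrow> 'a mpoly" where
  "homogenize p = (\<Sum>m\<in>Poly_Mapping.keys p. Poly_Mapping.single
     (m + Poly_Mapping.single 0 (total_degree p - mon_degree m)) (Poly_Mapping.lookup p m))"

section \<open>Projective hypersurfaces\<close>

definition proj_point :: "'a::field vec \<Rightarrow> 'a vec set" where
  "proj_point v = {c \<cdot>\<^sub>v v | c. True}"

definition PG :: "nat \<Rightarrow> 'a::field vec set set" where
  "PG r = {proj_point v | v. v \<in> carrier_vec (r + 1) \<and> v \<noteq> 0\<^sub>v (r + 1)}"

text \<open>
  The rational points of the projective closure in \<open>PG(r)\<close> of the affine hypersurface with equation
  \<open>p = 0\<close>, where \<open>p\<close> is a polynomial in \<open>X\<^sub>1, \<dots>, X\<^sub>r\<close>.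
\<close>

definition hypersurface :: "nat \<Rightarrow> 'a::field mpoly \<Rightarrow> 'a vec set set" where
  "hypersurface r p =
     {proj_point v | v. v \<in> carrier_vec (r + 1) \<and> v \<noteq> 0\<^sub>v (r + 1) \<and>
       meval (\<lambda>i. v $ i) (homogenize p) = 0}"

section \<open>The hypersurface \<open>V\<^sup>r\<^sub>\<epsilon>\<close>\<close>

text \<open>
  Here \<open>q = 2 ^ e\<close> and \<open>s\<close> is the exponent \<open>\<sigma> = 2 ^ ((e + 1) / 2)\<close>; \<open>Gamma_poly e \<epsilon> x\<close> is
  \<open>\<Gamma>\<^sub>\<epsilon>(x)\<close> for a polynomial \<open>x\<close>.
\<close>

definition Gamma_poly :: "nat \<Rightarrow> 'a::field \<Rightarrow> 'a mpoly \<Rightarrow> 'a mpoly" where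
  "Gamma_poly e \<epsilon> x = (let q = 2 ^ e; s = 2 ^ ((e + 1) div 2) in
     (x + (x ^ q + x) * mconst \<epsilon>) ^ (s + 2) + (x ^ q + x) ^ s
     + (x ^ (2 * q) + x ^ 2) * mconst \<epsilon> + x ^ (q + 1) + x ^ 2)"

definition V_poly :: "nat \<Rightarrow> nat \<Rightarrow> 'a::field \<Rightarrow> 'a mpoly" where
  "V_poly r e \<epsilon> = (let q = 2 ^ e in
     mvar r ^ q + mvar r - (\<Sum>i = 1..r - 1. Gamma_poly e \<epsilon> (mvar i)))"

definition V_hyp :: "nat \<Rightarrow> nat \<Rightarrow> 'a::field \<Rightarrow> 'a vec set set" where
  "V_hyp r e \<epsilon> = hypersurface r (V_poly r e \<epsilon>)"

section \<open>Linear codes\<close>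

text \<open>
  The code of a point set depends on the order of the points and on the representatives, so it
  is described by all its possible generator matrices.
\<close>

definition generator_matrix :: "nat \<Rightarrow> 'a::field vec set set \<Rightarrow> 'a mat \<Rightarrow> bool" where
  "generator_matrix r \<Omega> G \<longleftrightarrow> G \<in> carrier_mat (r + 1) (card \<Omega>) \<and>
     bij_betw (\<lambda>j. proj_point (col G j)) {..<card \<Omega>} \<Omega>"

definition code_of :: "'a::field mat \<Rightarrow> 'a vec set" where
  "code_of G = vec_space.row_space (dim_col G) G"

definition supp :: "'a::zero vec \<Rightarrow> nat set" where
  "supp c = {i. i < dim_vec c \<and> c $ i \<noteq> 0}"

definition minimal_codeword :: "'a::field vec set \<Rightarrow> 'a vec \<Rightarrow> bool" where
  "minimal_codeword C c \<longleftrightarrow> c \<in> C \<and>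
     (\<forall>c'\<in>C. c' \<noteq> 0\<^sub>v (dim_vec c') \<and> supp c' \<subseteq> supp c \<longrightarrow> (\<exists>a. c' = a \<cdot>\<^sub>v c))"

definition minimal_code :: "'a::field vec set \<Rightarrow> bool" where
  "minimal_code C \<longleftrightarrow> (\<forall>c\<in>C. c \<noteq> 0\<^sub>v (dim_vec c) \<longrightarrow> minimal_codeword C c)"

lemma generator_matrix_exists:
  assumes "finite \<Omega>" and "\<Omega> \<subseteq> PG r"
  shows "\<exists>G. generator_matrix r \<Omega> G"
proof -
  obtain f where f: "bij_betw f {..<card \<Omega>} \<Omega>"
    using ex_bij_betw_nat_finite[OF assms(1)] unfolding atLeast0LessThan by blast
  have "\<exists>v. v \<in> carrier_vec (r + 1) \<and> f j = proj_point v" if "j < card \<Omega>" for j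
  proof -
    have "f j \<in> PG r"
      using that f assms(2) bij_betwE by blast
    then show ?thesis
      unfolding PG_def by blast
  qed
  then obtain g where g: "\<And>j. j < card \<Omega> \<Longrightarrow>
      g j \<in> carrier_vec (r + 1) \<and> f j = proj_point (g j)"
    by metis
  define G where "G = mat_of_cols (r + 1) (map g [0..<card \<Omega>])"
  have "proj_point (col G j) = f j" if "j < card \<Omega>" for j
    using that g[OF that] by (simp add: G_def col_mat_of_cols)
  then have "bij_betw (\<lambda>j. proj_point (col G j)) {..<card \<Omega>} \<Omega>"
    using f bij_betw_cong[of "{..<card \<Omega>}" "\<lambda>j. proj_point (col G j)" f \<Omega>] by blast
  moreover have "G \<in> carrier_mat (r + 1) (card \<Omega>)"
    by (auto simp: G_def)
  ultimately show ?thesis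
    unfolding generator_matrix_def by blast
qed

lemma V_hyp_generator_matrix_exists:
  fixes \<epsilon> :: "'a::{field,finite}"
  shows "\<exists>G. generator_matrix r (V_hyp r e \<epsilon>) G"
proof (rule generator_matrix_exists)
  have "finite (carrier_vec n :: 'a vec set)" for n
  proof -
    have "carrier_vec n \<subseteq> vec_of_list ` {xs :: 'a list. set xs \<subseteq> UNIV \<and> length xs = n}"
    proof
      fix v :: "'a vec"
      assume "v \<in> carrier_vec n"
      then have "v = vec_of_list (list_of_vec v)" "length (list_of_vec v) = n"
        by (auto simp: vec_list)
      then show "v \<in> vec_of_list ` {xs :: 'a list. set xs \<subseteq> UNIV \<and> length xs = n}"
        by blast
    qed
    then show ?thesis
      using finite_lists_length_eq[OF finite_UNIV, of n] by (rule finite_subset[OF _ finite_imageI])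
  qed
  then have "finite (proj_point ` (carrier_vec (r + 1) :: 'a vec set))"
    by blast
  then show "finite (V_hyp r e \<epsilon>)"
    by (rule rev_finite_subset) (auto simp: V_hyp_def hypersurface_def)
  show "V_hyp r e \<epsilon> \<subseteq> PG r"
    by (auto simp: V_hyp_def hypersurface_def PG_def)
qed

end

theory Submission
  imports Defs "HOL-Computational_Algebra.Polynomial" "HOL-Number_Theory.Residues"
begin

text \<open>
  Write \<open>q = 2 ^ e\<close>, \<open>s = 2 ^ ((e + 1) / 2)\<close> and \<open>x = x0 + x1 \<epsilon>\<close> with \<open>x0, x1\<close> in the subfield of
  order \<open>q\<close>. Then \<open>\<Gamma>(x) = x0 ^ (s + 2) + x0 x1 + x1 ^ s\<close>. The code is minimal iff every plane
  section of the surface spans its plane.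

  The top form of the equation is \<open>\<epsilon> ^ (s + 2) (X1 ^ (q (s + 2)) + X2 ^ (q (s + 2)))\<close>, so the section
  at infinity is \<open>X1 ^ (s + 2) = X2 ^ (s + 2)\<close>. If \<open>e \<equiv> 1\<close> modulo \<open>4\<close>, then \<open>s + 2\<close> is prime
  to \<open>q\<^sup>2 - 1\<close>, the section is the single line \<open>X1 = X2\<close>, and the plane at infinity is not spanned.
  If \<open>e \<equiv> 3\<close> modulo \<open>4\<close>, then \<open>3\<close> divides \<open>s + 2\<close> and the section contains the lines
  \<open>X1 = X2\<close> and \<open>X1 = \<omega> X2\<close> through \<open>(0, 0, 0, 1)\<close>, with \<open>\<omega>\<close> a primitive cube root of unity. A
  plane not through that point meets these lines in two points, and also contains an affine point of
  the surface; an affine plane through it contains several points of the surface over each point of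
  its projection.
\<close>

section \<open>Evaluation and degree of polynomials\<close>

lemma sum_single_lookup: "(\<Sum>m\<in>Poly_Mapping.keys p. Poly_Mapping.single m (Poly_Mapping.lookup p m)) = p"
  by (rule poly_mapping_eqI) (auto simp: lookup_sum lookup_single when_def in_keys_iff)

text \<open>A ring homomorphism \<open>c\<close> on coefficients and a monoid homomorphism
  \<open>h\<close> on monomials induce a ring homomorphism on polynomials. This serves both
  evaluation at a point and restriction to a ray.\<close>

locale mpoly_subst =
  fixes c :: "'a::comm_ring_1 \<Rightarrow> 'b::comm_ring_1" and h :: "(nat \<Rightarrow>\<^sub>0 nat) \<Rightarrow> 'b"
  assumes c_0: "c 0 = 0" and c_1: "c 1 = 1"
    and c_add: "c (a + b) = c a + c b" and c_mult: "c (a * b) = c a * c b"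
    and h_0: "h 0 = 1" and h_add: "h (m + n) = h m * h n"
begin

definition subst :: "'a mpoly \<Rightarrow> 'b" where
  "subst p = (\<Sum>m\<in>Poly_Mapping.keys p. c (Poly_Mapping.lookup p m) * h m)"

lemma subst_0: "subst 0 = 0"
  by (simp add: subst_def)

lemma subst_single: "subst (Poly_Mapping.single m a) = c a * h m"
  by (simp add: subst_def c_0)

lemma subst_1: "subst 1 = 1"
  by (simp add: subst_def c_1 h_0)

lemma subst_add: "subst (p + q) = subst p + subst q"
  unfolding subst_def
  by (rule setsum_keys_plus_distrib[where f = "\<lambda>m a. c a * h m"]) (auto simp: c_0 c_add distrib_right)

lemma subst_minus: "subst (p - q) = subst p - subst q"
  using subst_add[of "p - q" q] by simp

lemma subst_sum: "subst (sum f A) = (\<Sum>i\<in>A. subst (f i))"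
  by (induction A rule: infinite_finite_induct) (simp_all add: subst_0 subst_add)

lemma subst_mult: "subst (p * q) = subst p * subst q"
proof -
  let ?t = "\<lambda>p m. Poly_Mapping.single m (Poly_Mapping.lookup p m)"
  have "p * q = (\<Sum>m\<in>Poly_Mapping.keys p. \<Sum>n\<in>Poly_Mapping.keys q. ?t p m * ?t q n)"
    by (simp add: sum_single_lookup flip: sum_product)
  then have "subst (p * q) = (\<Sum>m\<in>Poly_Mapping.keys p. \<Sum>n\<in>Poly_Mapping.keys q.
      c (Poly_Mapping.lookup p m) * h m * (c (Poly_Mapping.lookup q n) * h n))"
    by (simp add: subst_sum mult_single subst_single c_mult h_add mult_ac)
  then show ?thesis
    by (simp add: subst_def sum_product)
qed

lemma subst_power: "subst (p ^ n) = subst p ^ n"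
  by (induction n) (simp_all add: subst_1 subst_mult)

lemmas subst_simps = subst_single subst_add subst_minus subst_mult subst_power

end

definition mon_eval :: "(nat \<Rightarrow> 'a::comm_ring_1) \<Rightarrow> (nat \<Rightarrow>\<^sub>0 nat) \<Rightarrow> 'a" where
  "mon_eval x m = (\<Prod>i\<in>Poly_Mapping.keys m. x i ^ Poly_Mapping.lookup m i)"

lemma mon_eval_0: "mon_eval x 0 = 1"
  by (simp add: mon_eval_def)

lemma mon_eval_single: "mon_eval x (Poly_Mapping.single i k) = x i ^ k"
  by (simp add: mon_eval_def)

lemma mon_eval_add: "mon_eval x (m + n) = mon_eval x m * mon_eval x n"
proof -
  let ?A = "Poly_Mapping.keys m \<union> Poly_Mapping.keys n"
  have *: "mon_eval x k = (\<Prod>i\<in>?A. x i ^ Poly_Mapping.lookup k i)"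
    if "Poly_Mapping.keys k \<subseteq> ?A" for k
    unfolding mon_eval_def using that by (intro prod.mono_neutral_left) (auto simp: in_keys_iff)
  show ?thesis
    using keys_add[of m n] by (simp add: * lookup_add power_add prod.distrib)
qed

lemma mon_degree_0: "mon_degree 0 = 0"
  by (simp add: mon_degree_def)

lemma mon_degree_single: "mon_degree (Poly_Mapping.single i k) = k"
  by (simp add: mon_degree_def)

lemma mon_degree_add: "mon_degree (m + n) = mon_degree m + mon_degree n"
  unfolding mon_degree_def
  by (rule setsum_keys_plus_distrib[where f = "\<lambda>_ k. k"]) auto

interpretation eval: mpoly_subst "\<lambda>a. a" "mon_eval x" for x :: "nat \<Rightarrow> 'a::comm_ring_1"
  by standard (auto simp: mon_eval_0 mon_eval_add)

lemma meval_eq_subst: "meval x p = eval.subst x p"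
  by (simp add: meval_def eval.subst_def mon_eval_def)

text \<open>Evaluation along a line through the origin: \<open>p(t x)\<close> as a polynomial in \<open>t\<close>.\<close>

interpretation ray: mpoly_subst "\<lambda>a. [:a:]" "\<lambda>m. Polynomial.monom (mon_eval x m) (mon_degree m)"
  for x :: "nat \<Rightarrow> 'a::comm_ring_1"
  by standard (auto simp: mon_eval_0 mon_eval_add mon_degree_0 mon_degree_add mult_monom one_pCons monom_0)

section \<open>Homogenization at affine points and at infinity\<close>

lemma meval_homogenize:
  "meval x (homogenize p) = (\<Sum>m\<in>Poly_Mapping.keys p.
     Poly_Mapping.lookup p m * (mon_eval x m * x 0 ^ (total_degree p - mon_degree m)))"
  by (simp add: meval_eq_subst homogenize_def eval.subst_sum eval.subst_single mon_eval_add mon_eval_single)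

lemma meval_homogenize_affine:
  assumes "x 0 = 1"
  shows "meval x (homogenize p) = meval x p"
  by (simp add: meval_homogenize assms) (simp add: meval_def mon_eval_def)

lemma mon_degree_le_total_degree:
  "m \<in> Poly_Mapping.keys p \<Longrightarrow> mon_degree m \<le> total_degree p"
  by (simp add: total_degree_def)

lemma coeff_ray: "Polynomial.coeff (ray.subst x p) n =
    (\<Sum>m\<in>Poly_Mapping.keys p. if mon_degree m = n then Poly_Mapping.lookup p m * mon_eval x m else 0)"
  by (auto simp: ray.subst_def coeff_sum intro!: sum.cong)

text \<open>The factor \<open>x 0 ^ (total_degree p - mon_degree m)\<close> is 1 for monomials of
  full degree and 0 for all others, so only the top form survives; on a ray it is a single
  coefficient.\<close>

lemma meval_homogenize_infinity:
  assumes "x 0 = 0"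
  shows "meval x (homogenize p) = Polynomial.coeff (ray.subst x p) (total_degree p)"
  unfolding meval_homogenize coeff_ray assms
  by (rule sum.cong) (auto simp: zero_power_eq dest: mon_degree_le_total_degree)

section \<open>Degree bounds and top coefficients\<close>

lemma total_degree_le_iff: "total_degree p \<le> n \<longleftrightarrow> (\<forall>m\<in>Poly_Mapping.keys p. mon_degree m \<le> n)"
  by (simp add: total_degree_def)

lemma total_degree_add_le:
  "total_degree p \<le> n \<Longrightarrow> total_degree q \<le> n \<Longrightarrow> total_degree (p + q) \<le> n"
  using keys_add[of p q] by (auto simp: total_degree_le_iff)

lemma total_degree_uminus: "total_degree (- p) = total_degree p"
proof -
  have "Poly_Mapping.keys (- p) = Poly_Mapping.keys p"
    by (auto simp: in_keys_iff)
  then show ?thesis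
    by (simp add: total_degree_def)
qed

lemma total_degree_minus_le:
  "total_degree p \<le> n \<Longrightarrow> total_degree q \<le> n \<Longrightarrow> total_degree (p - q) \<le> n"
  using total_degree_add_le[of p n "- q"] by (simp add: total_degree_uminus)

lemma total_degree_mult_le:
  assumes "total_degree p \<le> a" "total_degree q \<le> b"
  shows "total_degree (p * q) \<le> a + b"
  unfolding total_degree_le_iff
proof
  fix m assume "m \<in> Poly_Mapping.keys (p * q)"
  then obtain k l where "m = k + l" "k \<in> Poly_Mapping.keys p" "l \<in> Poly_Mapping.keys q"
    using keys_mult[of p q] by blast
  then show "mon_degree m \<le> a + b"
    using assms mon_degree_le_total_degree[of k p] mon_degree_le_total_degree[of l q]
    by (simp add: mon_degree_add)
qed

lemma total_degree_power_le: "total_degree p \<le> a \<Longrightarrow> total_degree (p ^ n) \<le> n * a"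
proof (induction n)
  case 0
  then show ?case by (simp add: total_degree_def mon_degree_0)
next
  case (Suc n)
  then show ?case using total_degree_mult_le[of p a "p ^ n" "n * a"] by simp
qed

lemma total_degree_mconst: "total_degree (mconst a) = 0"
  by (simp add: total_degree_def mconst_def mon_degree_0)

lemma total_degree_mvar_le: "total_degree (mvar i) \<le> 1"
  by (simp add: total_degree_def mvar_def mon_degree_single)

lemma degree_ray_le: "Polynomial.degree (ray.subst x p) \<le> total_degree p"
  by (rule degree_le) (auto simp: coeff_ray dest!: mon_degree_le_total_degree intro!: sum.neutral)

text \<open>As \<open>a\<close> and \<open>b\<close> are only upper bounds, top coefficients can be
  computed without knowing exact degrees.\<close>

lemma coeff_mult_bound:
  fixes p q :: "'a::comm_semiring_1 poly"
  assumes "Polynomial.degree p \<le> a" "Polynomial.degree q \<le> b"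
  shows "Polynomial.coeff (p * q) (a + b) = Polynomial.coeff p a * Polynomial.coeff q b"
proof -
  have "Polynomial.coeff p i * Polynomial.coeff q (a + b - i) = (if i = a then Polynomial.coeff p a * Polynomial.coeff q b else 0)"
    if "i \<le> a + b" for i
  proof -
    consider "i = a" | "i > a" | "a + b - i > b" using \<open>i \<le> a + b\<close> by linarith
    then show ?thesis by cases (use assms in \<open>auto simp: coeff_eq_0\<close>)
  qed
  then show ?thesis
    by (simp add: coeff_mult)
qed

lemma coeff_power_bound:
  fixes p :: "'a::comm_semiring_1 poly"
  assumes "Polynomial.degree p \<le> a"
  shows "Polynomial.coeff (p ^ n) (n * a) = Polynomial.coeff p a ^ n"
proof (induction n)
  case (Suc n)
  have "Polynomial.degree (p ^ n) \<le> n * a"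
    using degree_power_le[of p n] assms by (metis (no_types, opaque_lifting) le_trans mult.commute mult_le_mono1)
  then show ?case
    using coeff_mult_bound[OF assms, of "p ^ n" "n * a"] Suc by simp
qed simp

section \<open>The top form of the equation\<close>

definition Gamma_val :: "nat \<Rightarrow> 'a::field \<Rightarrow> 'a \<Rightarrow> 'a" where
  "Gamma_val e \<epsilon> x = (x + (x ^ 2 ^ e + x) * \<epsilon>) ^ (2 ^ ((e + 1) div 2) + 2) + (x ^ 2 ^ e + x) ^ 2 ^ ((e + 1) div 2)
     + (x ^ (2 * 2 ^ e) + x ^ 2) * \<epsilon> + x ^ (2 ^ e + 1) + x ^ 2"

lemma eval_mvar: "eval.subst x (mvar i) = x i"
  by (simp add: mvar_def eval.subst_single mon_eval_single)

lemma eval_mconst: "eval.subst x (mconst a) = a"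
  by (simp add: mconst_def eval.subst_single mon_eval_0)

lemma meval_V_poly:
  "meval x (V_poly r e \<epsilon>) = x r ^ 2 ^ e + x r - (\<Sum>i = 1..r - 1. Gamma_val e \<epsilon> (x i))"
  unfolding meval_eq_subst V_poly_def Gamma_poly_def Let_def Gamma_val_def
  by (simp only: eval.subst_simps eval.subst_sum eval_mvar eval_mconst)

lemma ray_mvar: "ray.subst x (mvar i) = Polynomial.monom (x i) 1"
  by (simp add: mvar_def ray.subst_single mon_eval_single mon_degree_single smult_monom)

lemma ray_mconst: "ray.subst x (mconst a) = [:a:]"
  by (simp add: mconst_def ray.subst_single mon_eval_0 mon_degree_0 monom_0)

lemma total_degree_mvar_power_le: "n \<le> k \<Longrightarrow> total_degree (mvar i ^ n) \<le> k"
  by (rule order_trans[OF total_degree_power_le[OF total_degree_mvar_le]]) simp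

lemma total_degree_mult_mconst_le: "total_degree p \<le> n \<Longrightarrow> total_degree (p * mconst a) \<le> n"
  using total_degree_mult_le[of p n "mconst a" 0] by (simp add: total_degree_mconst)

text \<open>The base \<open>B\<close> of the first power has degree at most \<open>q\<close>, with
  coefficient \<open>\<epsilon> * x i ^ q\<close> there; the other summands have degree at most
  \<open>s * q\<close>, which is below \<open>D\<close>.\<close>

lemma Gamma_poly_top:
  fixes \<epsilon> :: "'a::field"
  assumes "e \<ge> 1"
  defines "D \<equiv> (2 ^ ((e + 1) div 2) + 2) * 2 ^ e"
  shows "total_degree (Gamma_poly e \<epsilon> (mvar i)) \<le> D"
    and "Polynomial.coeff (ray.subst x (Gamma_poly e \<epsilon> (mvar i))) D
      = (\<epsilon> * x i ^ 2 ^ e) ^ (2 ^ ((e + 1) div 2) + 2)"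
proof -
  define q where "q = (2 ^ e :: nat)"
  define s where "s = (2 ^ ((e + 1) div 2) :: nat)"
  have q: "q \<ge> 2" using power_increasing[of 1 e "2::nat"] assms by (simp add: q_def)
  have s: "s \<ge> 2" using power_increasing[of 1 "(e + 1) div 2" "2::nat"] assms by (simp add: s_def)
  have D: "D = (s + 2) * q" by (simp add: D_def s_def q_def)
  define X where "X = (mvar i :: 'a mpoly)"
  define B where "B = X + (X ^ q + X) * mconst \<epsilon>"
  define R where "R = (X ^ q + X) ^ s + (X ^ (2 * q) + X ^ 2) * mconst \<epsilon> + X ^ (q + 1) + X ^ 2"
  have Gamma: "Gamma_poly e \<epsilon> (mvar i) = B ^ (s + 2) + R"
    by (simp add: Gamma_poly_def Let_def B_def R_def X_def q_def s_def add.assoc)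
  have Xn: "total_degree (X ^ n) \<le> k" if "n \<le> k" for n k
    unfolding X_def using that by (rule total_degree_mvar_power_le)
  have X1: "total_degree X \<le> k" if "1 \<le> k" for k
    using Xn[of 1 k] that by simp
  have Xq: "total_degree (X ^ q + X) \<le> q"
    using q by (intro total_degree_add_le Xn X1) auto
  then have B: "total_degree B \<le> q"
    unfolding B_def using q by (intro total_degree_add_le total_degree_mult_mconst_le Xn X1) auto
  have "2 * q \<le> s * q"
    using s by simp
  then have R: "total_degree R \<le> s * q"
    unfolding R_def using q
    by (intro total_degree_add_le total_degree_mult_mconst_le total_degree_power_le Xq Xn) linarith+
  show "total_degree (Gamma_poly e \<epsilon> (mvar i)) \<le> D"
    unfolding Gamma D using R by (intro total_degree_add_le total_degree_power_le B) auto
  have "Polynomial.coeff (ray.subst x R) D = 0"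
    using q degree_ray_le[of x R] R by (intro coeff_eq_0) (simp add: D)
  moreover have "Polynomial.coeff (ray.subst x B) q = \<epsilon> * x i ^ q"
    using q by (simp add: B_def X_def ray.subst_simps ray_mvar ray_mconst monom_power)
  moreover have "Polynomial.degree (ray.subst x B) \<le> q"
    using degree_ray_le[of x B] B by linarith
  ultimately show "Polynomial.coeff (ray.subst x (Gamma_poly e \<epsilon> (mvar i))) D
      = (\<epsilon> * x i ^ 2 ^ e) ^ (2 ^ ((e + 1) div 2) + 2)"
    unfolding q_def[symmetric] s_def[symmetric] Gamma D
    by (simp only: ray.subst_simps coeff_add coeff_power_bound) simp
qed

lemma V_poly_top:
  fixes \<epsilon> :: "'a::field"
  assumes "e \<ge> 1" "r \<ge> 2" "\<epsilon> \<noteq> 0"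
  shows "Polynomial.coeff (ray.subst x (V_poly r e \<epsilon>)) (total_degree (V_poly r e \<epsilon>))
     = - (\<Sum>i = 1..r - 1. (\<epsilon> * x i ^ 2 ^ e) ^ (2 ^ ((e + 1) div 2) + 2))"
proof -
  define q where "q = (2 ^ e :: nat)"
  define s where "s = (2 ^ ((e + 1) div 2) :: nat)"
  define D where "D = (s + 2) * q"
  have q: "q \<ge> 2" using power_increasing[of 1 e "2::nat"] assms by (simp add: q_def)
  then have D: "D > q" "D > 1" by (simp_all add: D_def)
  note Gamma = Gamma_poly_top[OF assms(1), where \<epsilon> = \<epsilon>, folded q_def s_def]
  have V: "V_poly r e \<epsilon> = mvar r ^ q + mvar r - (\<Sum>i = 1..r - 1. Gamma_poly e \<epsilon> (mvar i))"
    by (simp add: V_poly_def Let_def q_def)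
  have Gamma_coeff: "Polynomial.coeff (ray.subst x (Gamma_poly e \<epsilon> (mvar i))) D = (\<epsilon> * x i ^ q) ^ (s + 2)" for x i
    unfolding D_def by (rule Gamma(2))
  have Gamma_degree: "total_degree (Gamma_poly e \<epsilon> (mvar i)) \<le> D" for i
    unfolding D_def by (rule Gamma(1))
  have coeff: "Polynomial.coeff (ray.subst x (V_poly r e \<epsilon>)) D
     = - (\<Sum>i = 1..r - 1. (\<epsilon> * x i ^ q) ^ (s + 2))" for x
    using D by (simp add: V ray.subst_simps ray.subst_sum ray_mvar monom_power coeff_sum Gamma_coeff)
  have "total_degree (\<Sum>i\<in>A. Gamma_poly e \<epsilon> (mvar i)) \<le> D" for A
    by (induction A rule: infinite_finite_induct)
       (simp_all add: total_degree_add_le Gamma_degree total_degree_def[of 0])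
  then have "total_degree (V_poly r e \<epsilon>) \<le> D"
    unfolding V using D
    by (intro total_degree_minus_le total_degree_add_le total_degree_mvar_power_le
        order_trans[OF total_degree_mvar_le]) auto
  moreover have "\<not> total_degree (V_poly r e \<epsilon>) < D"
  proof
    \<comment> \<open>Along the \<open>X1\<close> axis only the summand \<open>i = 1\<close>
      survives, and its coefficient \<open>\<epsilon> ^ (s + 2)\<close> is nonzero; hence the bound
      \<open>D\<close> is attained.\<close>
    let ?x = "\<lambda>i. if i = 1 then 1 else 0 :: 'a"
    assume "total_degree (V_poly r e \<epsilon>) < D"
    then have "Polynomial.coeff (ray.subst ?x (V_poly r e \<epsilon>)) D = 0"
      using degree_ray_le[of ?x "V_poly r e \<epsilon>"] by (intro coeff_eq_0) simp
    moreover have "(\<Sum>i = 1..r - 1. (\<epsilon> * ?x i ^ q) ^ (s + 2)) = (\<Sum>i = 1..r - 1. if i = 1 then \<epsilon> ^ (s + 2) else 0)"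
      using q by (intro sum.cong) auto
    ultimately have "(\<Sum>i = 1..r - 1. if i = 1 then \<epsilon> ^ (s + 2) else 0) = 0"
      unfolding coeff by (simp only: neg_equal_0_iff_equal)
    then show False
      using assms by (auto split: if_splits)
  qed
  ultimately have "total_degree (V_poly r e \<epsilon>) = D" by simp
  then show ?thesis
    unfolding q_def[symmetric] s_def[symmetric] using coeff by simp
qed

section \<open>Arithmetic in the field of order \<open>2 ^ (2 e)\<close>\<close>

lemma CHAR_eq_2:
  assumes "card (UNIV :: 'a::{field,finite} set) = 2 ^ n"
  shows "CHAR('a) = 2"
proof -
  have "CHAR('a) > 0"
    by (rule finite_imp_CHAR_pos) simp
  then have "prime CHAR('a)"
    by (rule prime_CHAR_semidom)
  moreover have "CHAR('a) dvd 2 ^ n"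
    using CHAR_dvd_CARD[where 'a = 'a] assms by simp
  ultimately show ?thesis
    using prime_dvd_power primes_dvd_imp_eq two_is_prime_nat by blast
qed

text \<open>Multiplication by a nonzero \<open>x\<close> permutes the nonzero elements; comparing
  the products over them gives the claim.\<close>

lemma power_card_field:
  fixes x :: "'a::{field,finite}"
  shows "x ^ card (UNIV :: 'a set) = x"
proof (cases "x = 0")
  case False
  let ?U = "UNIV - {0 :: 'a}"
  have "bij_betw ((*) x) ?U ?U"
    by (rule bij_betwI[where g = "\<lambda>y. y / x"]) (use False in auto)
  then have "(\<Prod>y\<in>?U. x * y) = \<Prod>?U"
    by (rule prod.reindex_bij_betw)
  then have "x ^ card ?U = 1"
    by (simp add: prod.distrib)
  then have "x ^ Suc (card ?U) = x"
    by simp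
  moreover have "Suc (card ?U) = card (UNIV :: 'a set)"
    by (rule card_Suc_Diff1) simp_all
  ultimately show ?thesis by metis
qed (simp add: power_0_left)

text \<open>The subfield of order \<open>2 ^ e\<close> is not a separate type: membership of
  \<open>c\<close> is expressed by \<open>c ^ 2 ^ e = c\<close>.\<close>

locale tits_field =
  fixes e :: nat and \<epsilon> \<delta> :: "'a::{field,finite}"
  assumes odd_e: "odd e"
    and card_field: "card (UNIV :: 'a set) = (2 ^ e) ^ 2"
    and eps_notin: "\<epsilon> ^ 2 ^ e \<noteq> \<epsilon>"
    and delta_in: "\<delta> ^ 2 ^ e = \<delta>"
    and trace_delta: "(\<Sum>i<e. \<delta> ^ 2 ^ i) = 1"
    and eps_root: "\<epsilon>\<^sup>2 + \<epsilon> + \<delta> = 0"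
begin

definition q :: nat where "q = 2 ^ e"
definition s :: nat where "s = 2 ^ ((e + 1) div 2)"

lemma CHAR_2: "CHAR('a) = 2"
  using CHAR_eq_2[where 'a = 'a and n = "e * 2"] card_field by (simp add: power_mult)

lemma two_eq_0: "(2 :: 'a) = 0"
  using of_nat_CHAR[where 'a = 'a] by (simp add: CHAR_2)

lemma add_self [simp]: "(x :: 'a) + x = 0"
  using two_eq_0 by (simp flip: mult_2)

lemma add_self_left [simp]: "(x :: 'a) + (x + y) = y"
  by (simp flip: add.assoc)

lemma uminus_eq [simp]: "- (x :: 'a) = x"
  by (rule minus_unique) simp

lemma add_eq_0_iff_eq: "(x :: 'a) + y = 0 \<longleftrightarrow> x = y"
  by (simp add: add_eq_0_iff2)

lemma frob_add: "((x :: 'a) + y) ^ 2 ^ k = x ^ 2 ^ k + y ^ 2 ^ k"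
  using freshmans_dream'[of "2 ^ k" k x y] by (simp add: CHAR_2)

lemma square_add: "((x :: 'a) + y)\<^sup>2 = x\<^sup>2 + y\<^sup>2"
  using frob_add[of x y 1] by simp

lemma frob_inj: "(x :: 'a) ^ 2 ^ k = y ^ 2 ^ k \<longleftrightarrow> x = y"
proof
  assume "x ^ 2 ^ k = y ^ 2 ^ k"
  then have "(x + y) ^ 2 ^ k = 0"
    by (simp add: frob_add)
  then show "x = y"
    by (simp add: add_eq_0_iff_eq)
qed simp

lemma q_add: "((x :: 'a) + y) ^ q = x ^ q + y ^ q"
  by (simp add: q_def frob_add)

lemma q_q: "((x :: 'a) ^ q) ^ q = x"
  using power_card_field[of x] card_field by (simp add: q_def power_mult power2_eq_square flip: power_mult)

lemma power_q_commute: "((x :: 'a) ^ n) ^ q = (x ^ q) ^ n"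
  by (simp add: mult.commute flip: power_mult)

lemma e_pos: "e \<ge> 1"
  using odd_e by (cases e) auto

lemma eps_nz: "\<epsilon> \<noteq> 0"
  using eps_notin by (auto simp: power_0_left)

text \<open>Since \<open>\<delta>\<close> is fixed by the \<open>q\<close>-th power map,
  \<open>\<epsilon> ^ q\<close> is again a root of the quadratic of \<open>\<epsilon>\<close>. The
  roots are \<open>\<epsilon>\<close> and \<open>\<epsilon> + 1\<close>, and
  \<open>eps_notin\<close> excludes the first.\<close>

lemma eps_q: "\<epsilon> ^ q = \<epsilon> + 1"
proof -
  have "\<epsilon>\<^sup>2 = \<epsilon> + \<delta>"
    using eps_root by (simp add: add.assoc add_eq_0_iff_eq)
  moreover from this have "(\<epsilon> ^ q)\<^sup>2 = \<epsilon> ^ q + \<delta>"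
    using delta_in by (simp add: q_add flip: power_q_commute) (simp add: q_def)
  ultimately have "(\<epsilon> ^ q + \<epsilon>) * (\<epsilon> ^ q + \<epsilon> + 1) = 0"
    by (simp add: algebra_simps power2_eq_square two_eq_0)
  then show ?thesis
    using eps_notin by (auto simp: q_def add_eq_0_iff_eq add.assoc)
qed

section \<open>The relative trace and coordinates over the subfield\<close>

definition tr :: "'a \<Rightarrow> 'a" where "tr x = x ^ q + x"

lemma tr_q: "tr x ^ q = tr x"
  by (simp add: tr_def q_add q_q add.commute)

lemma tr_add: "tr (x + y) = tr x + tr y"
  by (simp add: tr_def q_add ac_simps)

lemma tr_mult: "c ^ q = c \<Longrightarrow> tr (c * x) = c * tr x"
  by (simp add: tr_def power_mult_distrib distrib_left)

lemma tr_in: "c ^ q = c \<Longrightarrow> tr c = 0"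
  by (simp add: tr_def)

lemma tr_eps: "tr \<epsilon> = 1"
  by (simp add: tr_def eps_q two_eq_0)

text \<open>In characteristic 2, \<open>x = (x + tr x * \<epsilon>) + tr x * \<epsilon>\<close>, so
  \<open>x0 = x + tr x * \<epsilon>\<close> and \<open>x1 = tr x\<close> are the coordinates of
  \<open>x\<close> in the basis \<open>1, \<epsilon>\<close>.\<close>

lemma coords: "(x + tr x * \<epsilon>) ^ q = x + tr x * \<epsilon>"
  by (simp add: q_add power_mult_distrib tr_q eps_q) (simp add: tr_def algebra_simps)

text \<open>The right-hand side is the form that defines the Tits ovoid.\<close>

lemma Gamma_val_coords:
  assumes "x0 ^ q = x0" "x1 ^ q = x1"
  shows "Gamma_val e \<epsilon> (x0 + x1 * \<epsilon>) = x0 ^ (s + 2) + x0 * x1 + x1 ^ s"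
proof -
  define x where "x = x0 + x1 * \<epsilon>"
  have t: "x ^ q + x = x1"
    using assms unfolding x_def tr_def[symmetric] tr_add by (simp add: tr_in tr_mult tr_eps)
  then have x: "x ^ q = x + x1"
    by (metis add_self_left add.commute)
  have "x ^ (2 * q) + x\<^sup>2 = x1\<^sup>2"
    using square_add[of "x ^ q" x] t by (simp add: mult.commute flip: power_mult)
  moreover have "x + x1 * \<epsilon> = x0"
    by (simp add: x_def add.assoc)
  ultimately have "Gamma_val e \<epsilon> x = x0 ^ (s + 2) + x1 ^ s + x1\<^sup>2 * \<epsilon> + x * (x + x1) + x\<^sup>2"
    unfolding Gamma_val_def q_def[symmetric] s_def[symmetric] t by (simp add: x)
  \<comment> \<open>Here \<open>x * (x + x1) + x * x = x * x1 = x0 * x1 + x1 * x1 *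
    \<epsilon>\<close>, and the two terms with \<open>\<epsilon>\<close> cancel.\<close>
  also have "\<dots> = x0 ^ (s + 2) + x0 * x1 + x1 ^ s"
    by (simp add: x_def algebra_simps power2_eq_square)
  finally show ?thesis
    by (simp add: x_def)
qed

lemma Gamma_val_0: "Gamma_val e \<epsilon> 0 = 0"
  using Gamma_val_coords[of 0 0] by (simp add: q_def s_def power_0_left)

text \<open>The coordinates of \<open>x\<close> lie in the subfield, hence so does the value; this
  makes the trace equation for \<open>z\<close> solvable.\<close>

lemma Gamma_val_q: "Gamma_val e \<epsilon> x ^ q = Gamma_val e \<epsilon> x"
proof -
  define x0 where "x0 = x + tr x * \<epsilon>"
  have "x = x0 + tr x * \<epsilon>"
    by (simp add: x0_def add.assoc)
  moreover have "x0 ^ q = x0"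
    unfolding x0_def by (rule coords)
  ultimately have "Gamma_val e \<epsilon> x = x0 ^ (s + 2) + x0 * tr x + tr x ^ s"
    using Gamma_val_coords[of x0 "tr x"] tr_q by simp
  then show ?thesis
    using \<open>x0 ^ q = x0\<close> tr_q by (simp only: q_add power_q_commute[of _ "s + 2"] power_q_commute[of _ s] power_mult_distrib)
qed

lemma tr_surj: "t ^ q = t \<Longrightarrow> \<exists>z. tr z = t"
  using tr_mult[of t \<epsilon>] tr_eps by auto

section \<open>Affine points of the surface\<close>

lemma exists_affine_over:
  obtains z where "tr z = Gamma_val e \<epsilon> x + Gamma_val e \<epsilon> y"
  using tr_surj[of "Gamma_val e \<epsilon> x + Gamma_val e \<epsilon> y"] by (auto simp: q_add Gamma_val_q)

text \<open>Choosing \<open>x0\<close> to cancel the linear term in \<open>x1\<close> leaves an equation \<open>x1 ^ s = k\<close>.\<close>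

lemma exists_affine_on_graph:
  obtains x where "tr (a * x + d) = Gamma_val e \<epsilon> x"
proof -
  define x0 where "x0 = tr (a * \<epsilon>)"
  define k where "k = tr (a * x0 + d) + x0 ^ (s + 2)"
  \<comment> \<open>This is the \<open>s\<close>-th root of \<open>k\<close>: the exponent times
    \<open>s\<close> equals \<open>q\<close>, and \<open>k ^ q = k\<close>.\<close>
  define x1 where "x1 = k ^ 2 ^ ((e - 1) div 2)"
  have x0: "x0 ^ q = x0"
    by (simp add: x0_def tr_q)
  have k: "k ^ q = k"
    using x0 by (simp only: k_def q_add tr_q power_q_commute[of _ "s + 2"])
  then have x1: "x1 ^ q = x1"
    unfolding x1_def by (subst power_q_commute) simp
  obtain n where n: "e = 2 * n + 1"
    using odd_e by (auto elim: oddE)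
  have "2 ^ ((e - 1) div 2) * s = q"
    unfolding s_def q_def by (simp add: n flip: power_add)
  then have "x1 ^ s = k ^ q"
    by (simp add: x1_def flip: power_mult)
  then have x1s: "x1 ^ s = k"
    using k by simp
  have "tr (a * (x0 + x1 * \<epsilon>) + d) = tr (a * x0 + d) + tr (x1 * (a * \<epsilon>))"
    unfolding tr_add[symmetric] by (simp add: algebra_simps)
  also have "\<dots> = Gamma_val e \<epsilon> (x0 + x1 * \<epsilon>)"
    unfolding Gamma_val_coords[OF x0 x1] tr_mult[OF x1] x1s x0_def[symmetric] by (simp add: k_def ac_simps)
  finally show ?thesis
    by (rule that)
qed

section \<open>Cube roots of unity and the exponent \<open>s + 2\<close>\<close>

text \<open>Both \<open>t = \<epsilon>\<close> and a suitable \<open>u\<close> have a known value of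
  \<open>t * t + t\<close>, namely \<open>\<delta>\<close> and \<open>1 + \<delta>\<close>; since
  squaring is additive, their sum has the value 1.\<close>

lemma exists_cube_root:
  obtains \<omega> :: 'a where "\<omega>\<^sup>2 = \<omega> + 1"
proof -
  obtain n where n: "e = 2 * n + 1"
    using odd_e by (auto elim: oddE)
  \<comment> \<open>The conjugates of \<open>\<delta>\<close> with even index up to
    \<open>e - 1\<close>. Squaring shifts them to the odd indices up to \<open>e\<close>, so
    \<open>u + u * u\<close> is the absolute trace of \<open>\<delta>\<close> plus the extra term
    \<open>\<delta> ^ 2 ^ e = \<delta>\<close>.\<close>
  define u where "u = (\<Sum>i\<le>n. \<delta> ^ 2 ^ (2 * i))"
  have sq: "u\<^sup>2 = (\<Sum>i\<le>n. \<delta> ^ 2 ^ (2 * i + 1))"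
  proof -
    have "(\<Sum>i\<in>A. \<delta> ^ 2 ^ (2 * i))\<^sup>2 = (\<Sum>i\<in>A. (\<delta> ^ 2 ^ (2 * i))\<^sup>2)" for A :: "nat set"
      by (induction A rule: infinite_finite_induct) (simp_all add: square_add)
    then show ?thesis
      by (simp add: u_def mult.commute flip: power_mult)
  qed
  have "(\<Sum>i\<le>m. \<delta> ^ 2 ^ (2 * i)) + (\<Sum>i\<le>m. \<delta> ^ 2 ^ (2 * i + 1)) = (\<Sum>i<2 * m + 2. \<delta> ^ 2 ^ i)" for m
    by (induction m) (simp_all add: lessThan_Suc add_ac)
  then have "u + u\<^sup>2 = (\<Sum>i<Suc e. \<delta> ^ 2 ^ i)"
    unfolding sq by (simp add: u_def n)
  also have "\<dots> = 1 + \<delta>"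
    using trace_delta delta_in by simp
  finally have "u\<^sup>2 = u + (1 + \<delta>)"
    by (metis add_self_left)
  moreover have "\<epsilon>\<^sup>2 = \<epsilon> + \<delta>"
    using eps_root by (simp add: add.assoc add_eq_0_iff_eq)
  ultimately have "(\<epsilon> + u)\<^sup>2 = (\<epsilon> + u) + 1"
    by (simp add: square_add ac_simps)
  then show ?thesis
    by (rule that)
qed

text \<open>For these \<open>e\<close> the number \<open>(e + 1) div 2\<close> is even, so
  \<open>s\<close> is a power of 4 and 3 divides \<open>s + 2\<close>; moreover
  \<open>\<omega>\<close> is a cube root of unity.\<close>

lemma cube_root_power:
  assumes "[e = 3] (mod 4)" "(\<omega> :: 'a)\<^sup>2 = \<omega> + 1"
  shows "\<omega> ^ (s + 2) = 1"
proof -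
  have "\<omega> ^ 3 = \<omega> * \<omega>\<^sup>2"
    by (simp add: numeral_eq_Suc)
  also have "\<dots> = \<omega>\<^sup>2 + \<omega>"
    by (simp add: assms distrib_left power2_eq_square[symmetric])
  also have "\<dots> = 1"
    by (simp add: assms add_ac)
  finally have "\<omega> ^ 3 = 1" .
  obtain k where k: "(e + 1) div 2 = 2 * k"
  proof
    show "(e + 1) div 2 = 2 * (e div 4 + 1)"
      using assms(1) unfolding cong_def by presburger
  qed
  have "[(4::nat) ^ k = 1 ^ k] (mod 3)"
    by (intro cong_pow) (simp add: cong_def)
  then have "[s + 2 = 1 + 2] (mod 3)"
    unfolding s_def k by (intro cong_add) (simp_all add: power_mult)
  then have "3 dvd s + 2"
    by (simp add: cong_def mod_eq_0_iff_dvd)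
  then obtain j where "s + 2 = 3 * j"
    by (rule dvdE)
  then show ?thesis
    using \<open>\<omega> ^ 3 = 1\<close> by (simp only: power_mult power_one)
qed

text \<open>Write \<open>u = x / y\<close> and \<open>s + 2 = 2 * (N + 1)\<close> with
  \<open>2 * N * N = q\<close>. Then \<open>u ^ N\<close> is the inverse of \<open>u\<close>, so
  \<open>u ^ q\<close> is the square of \<open>u\<close> and \<open>u = u ^ 4\<close>. As
  \<open>N\<close> is a power of 4, also \<open>u ^ N = u\<close>, whence \<open>u\<close> has
  square 1 and equals 1.\<close>

lemma power_s_plus_2_inj:
  assumes "[e = 1] (mod 4)" "(x :: 'a) ^ (s + 2) = y ^ (s + 2)"
  shows "x = y"
proof (cases "y = 0")
  case True
  then show ?thesis
    using assms(2) by (auto simp: power_0_left)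
next
  case False
  define u where "u = x / y"
  obtain k where k: "e = 4 * k + 1"
  proof
    show "e = 4 * (e div 4) + 1"
      using assms(1) unfolding cong_def by presburger
  qed
  define N where "N = (2 ^ (2 * k) :: nat)"
  have s: "s + 2 = (N + 1) * 2 ^ 1"
    unfolding s_def N_def by (simp add: k)
  have "u ^ (s + 2) = 1"
    using False assms(2) by (simp add: u_def power_divide)
  then have "(u ^ (N + 1)) ^ 2 ^ 1 = 1 ^ 2 ^ 1"
    unfolding s power_mult by (simp add: mult.commute)
  then have uN: "u ^ N * u = 1"
    unfolding frob_inj by (simp add: mult.commute)
  have "(u ^ N) ^ N * (u ^ N) = 1"
    using arg_cong[OF uN, of "\<lambda>t. t ^ N"] by (simp only: power_mult_distrib power_one)
  then have "(u ^ N) ^ N = u"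
    using uN by (metis mult.commute mult.left_commute mult_1_right)
  moreover have "N * N * 2 = q"
    unfolding N_def q_def by (simp add: k flip: power_add)
  ultimately have "u ^ q = u\<^sup>2"
    by (metis power_mult)
  then have "u = (u\<^sup>2)\<^sup>2"
    using q_q[of u] power_q_commute[of u 2] by simp
  then have u4: "u ^ 4 = u"
    by (simp flip: power_mult)
  have "u ^ 4 ^ k = u" for k
    by (induction k) (simp_all add: power_mult u4)
  then have "u ^ N = u"
    by (simp add: N_def power_mult)
  then have "u ^ 2 ^ 1 = 1 ^ 2 ^ 1"
    using uN by (simp add: power2_eq_square)
  then have "u = 1"
    unfolding frob_inj .
  then show ?thesis
    using False by (simp add: u_def)
qed

section \<open>Plane sections of the surface\<close>

text \<open>Homogeneous coordinates normalized to \<open>w = 1\<close> at affine points; at infinity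
  all nonzero representatives are kept.\<close>

definition on_V :: "'a \<Rightarrow> 'a \<Rightarrow> 'a \<Rightarrow> 'a \<Rightarrow> bool" where
  "on_V w x y z \<longleftrightarrow> w = 1 \<and> tr z = Gamma_val e \<epsilon> x + Gamma_val e \<epsilon> y
     \<or> w = 0 \<and> x ^ (s + 2) = y ^ (s + 2) \<and> (x, y, z) \<noteq> (0, 0, 0)"

text \<open>A linear form that vanishes on the section of a plane is a multiple of the form of that
  plane.\<close>

lemma plane_section_spans:
  assumes e: "[e = 3] (mod 4)"
    and sub: "\<And>w x y z. on_V w x y z \<Longrightarrow> d * w + a * x + b * y + c * z = 0 \<Longrightarrow>
      d' * w + a' * x + b' * y + c' * z = 0"
    and nz: "(d, a, b, c) \<noteq> (0, 0, 0, 0)"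
  shows "\<exists>k. d' = k * d \<and> a' = k * a \<and> b' = k * b \<and> c' = k * c"
proof -
  obtain \<omega> :: 'a where \<omega>: "\<omega>\<^sup>2 = \<omega> + 1"
    by (rule exists_cube_root)
  then have \<omega>_power: "\<omega> ^ (s + 2) = 1"
    by (rule cube_root_power[OF e])
  have \<omega>_1: "\<omega> \<noteq> 1"
    using \<omega> by auto
  \<comment> \<open>Points on the two lines at infinity through \<open>(0, 0, 0, 1)\<close>, one for
    each \<open>z\<close>.\<close>
  have inf: "on_V 0 1 1 z" "on_V 0 \<omega> 1 z" for z
    using \<omega>_power by (auto simp: on_V_def)
  have two_eqs: "\<alpha> = 0 \<and> \<beta> = 0" if "\<alpha> + \<beta> = 0" "\<alpha> * \<omega> + \<beta> = 0" for \<alpha> \<beta>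
  proof -
    have "\<alpha> * (\<omega> - 1) = 0"
      using that by (simp add: algebra_simps add_eq_0_iff_eq)
    then show ?thesis
      using that \<omega>_1 by auto
  qed
  \<comment> \<open>The plane misses \<open>(0, 0, 0, 1)\<close>, or passes through it without being
    the plane at infinity, or is the plane at infinity.\<close>
  consider "c \<noteq> 0" | "c = 0" "a \<noteq> 0 \<or> b \<noteq> 0" | "c = 0" "a = 0" "b = 0" "d \<noteq> 0"
    using nz by auto
  then show ?thesis
  proof cases
    case 1
    \<comment> \<open>Subtracting \<open>k\<close> times the form of the plane from the other form
      removes \<open>z\<close>; the claim becomes that the remaining coefficients \<open>D\<close>,
      \<open>A\<close>, \<open>B\<close> vanish.\<close>
    define k where "k = c' / c"
    define D A B where "D = d' + k * d" and "A = a' + k * a" and "B = b' + k * b"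
    have DAB: "D * w + A * x + B * y = 0"
      if "on_V w x y ((d * w + a * x + b * y) / c)" for w x y
    proof -
      define z where "z = (d * w + a * x + b * y) / c"
      have cz: "c * z = d * w + a * x + b * y"
        using 1 by (simp add: z_def)
      then have "d * w + a * x + b * y + c * z = 0"
        by simp
      moreover have "on_V w x y z"
        using that by (simp only: z_def)
      ultimately have "d' * w + a' * x + b' * y + c' * z = 0"
        using sub by blast
      moreover have "c' * z = k * (d * w + a * x + b * y)"
        using 1 by (simp add: k_def flip: cz)
      ultimately show ?thesis
        by (simp add: D_def A_def B_def algebra_simps)
    qed
    \<comment> \<open>The plane meets each of the two lines at infinity in one point; these give
      \<open>A + B = 0\<close> and \<open>A * \<omega> + B = 0\<close>.\<close>
    have "A = 0 \<and> B = 0"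
      by (rule two_eqs) (use DAB[OF inf(1)] DAB[OF inf(2)] in simp_all)
    \<comment> \<open>An affine point of the section with \<open>y = 0\<close>, which then forces
      \<open>D = 0\<close>.\<close>
    moreover obtain x where "tr (a / c * x + d / c) = Gamma_val e \<epsilon> x"
      by (rule exists_affine_on_graph)
    then have "on_V 1 x 0 ((d * 1 + a * x + b * 0) / c)"
      by (simp add: on_V_def Gamma_val_0 add_divide_distrib add.commute)
    then have "D * 1 + A * x + B * 0 = 0"
      by (rule DAB)
    ultimately have "D = 0" "A = 0" "B = 0"
      by simp_all
    then show ?thesis
      using 1 by (intro exI[of _ k]) (auto simp: D_def A_def B_def k_def add_eq_0_iff_eq)
  next
    case 2
    \<comment> \<open>Since \<open>tr 1 = 0\<close>, both \<open>z\<close> and \<open>z + 1\<close>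
      lie over \<open>(x, y)\<close>; their difference isolates \<open>c'\<close>, and what remains
      is a condition on the projected line \<open>d + a * x + b * y = 0\<close>.\<close>
    have aff: "c' = 0 \<and> d' + a' * x + b' * y = 0" if "d + a * x + b * y = 0" for x y
    proof -
      obtain z where z: "tr z = Gamma_val e \<epsilon> x + Gamma_val e \<epsilon> y"
        by (rule exists_affine_over)
      then have "on_V 1 x y z" "on_V 1 x y (z + 1)"
        by (simp_all add: on_V_def tr_add tr_in)
      from sub[OF this(1)] sub[OF this(2)] have z0: "d' + a' * x + b' * y + c' * z = 0"
        and "(d' + a' * x + b' * y + c' * z) + c' = 0"
        using 2 that by (simp_all add: distrib_left flip: add.assoc)
      then have "c' = 0"
        unfolding z0 by simp
      then show ?thesis
        using z0 by simp
    qed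
    show ?thesis
    proof (cases "a = 0")
      case True
      then have b: "b \<noteq> 0" using 2 by simp
      \<comment> \<open>Two points of the projected line determine the other form up to a
        factor.\<close>
      from aff[of 0 "d / b"] aff[of 1 "d / b"] b True
      have "c' = 0" "d' + b' * d / b = 0" "d' + a' + b' * d / b = 0"
        by simp_all
      then have "c' = 0" "d' = b' / b * d" "a' = 0"
        by (auto simp: add_eq_0_iff_eq two_eq_0)
      then show ?thesis
        using b True 2 by (intro exI[of _ "b' / b"]) simp
    next
      case False
      from aff[of "d / a" 0] aff[of "(d + b) / a" 1] False
      have "c' = 0" and d': "d' + a' * d / a = 0" and "d' + a' * (d + b) / a + b' = 0"
        by (simp_all add: add.assoc)
      moreover from this(3) have "d' + a' * d / a + (a' * b / a + b') = 0"
        by (simp add: distrib_left add_divide_distrib add.assoc)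
      then have "a' * b / a + b' = 0"
        unfolding d' by simp
      ultimately have "c' = 0" "d' = a' / a * d" "b' = a' / a * b"
        by (simp_all add: add_eq_0_iff_eq)
      then show ?thesis
        using False 2 by (intro exI[of _ "a' / a"]) simp
    qed
  next
    case 3
    \<comment> \<open>Each line at infinity lies entirely in this plane, so \<open>z = 0\<close> and
      \<open>z = 1\<close> may be compared.\<close>
    have "a' + b' + c' * z = 0" "a' * \<omega> + b' + c' * z = 0" for z
      using sub[OF inf(1)[of z]] sub[OF inf(2)[of z]] 3 by simp_all
    from this[of 0] this(1)[of 1] have "c' = 0" "a' + b' = 0" "a' * \<omega> + b' = 0"
      by auto
    then show ?thesis
      using 3 two_eqs[of a' b'] by (intro exI[of _ "d' / d"]) simp
  qed
qed

section \<open>The surface in homogeneous coordinates\<close>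

lemma hypersurface_affine:
  assumes "x 0 = 1"
  shows "meval x (homogenize (V_poly 3 e \<epsilon>)) = 0 \<longleftrightarrow> tr (x 3) = Gamma_val e \<epsilon> (x 1) + Gamma_val e \<epsilon> (x 2)"
proof -
  have "{1..3 - 1} = {1, 2 :: nat}" by auto
  then show ?thesis
    using assms by (simp add: meval_homogenize_affine meval_V_poly tr_def q_def add_eq_0_iff_eq del: One_nat_def)
qed

text \<open>The common factor \<open>\<epsilon> ^ (s + 2)\<close> of the top form is nonzero and the
  \<open>q\<close>-th power map is injective, so both can be cancelled.\<close>

lemma hypersurface_infinity:
  assumes "x 0 = 0"
  shows "meval x (homogenize (V_poly 3 e \<epsilon>)) = 0 \<longleftrightarrow> x 1 ^ (s + 2) = x 2 ^ (s + 2)"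
proof -
  have "{1..3 - 1} = {1, 2 :: nat}" by auto
  then have "meval x (homogenize (V_poly 3 e \<epsilon>)) = 0 \<longleftrightarrow>
      (\<epsilon> * x 1 ^ q) ^ (s + 2) = (\<epsilon> * x 2 ^ q) ^ (s + 2)"
    using V_poly_top[OF e_pos _ eps_nz, of 3 x, folded s_def q_def] assms
    by (simp add: meval_homogenize_infinity add_eq_0_iff_eq del: power_add One_nat_def)
  also have "\<dots> \<longleftrightarrow> (x 1 ^ (s + 2)) ^ q = (x 2 ^ (s + 2)) ^ q"
    using eps_nz unfolding power_q_commute[of _ "s + 2"] by (simp add: power_mult_distrib del: power_add)
  also have "\<dots> \<longleftrightarrow> x 1 ^ (s + 2) = x 2 ^ (s + 2)"
    unfolding q_def frob_inj ..
  finally show ?thesis .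
qed

end

section \<open>Codewords as linear functionals\<close>

lemma code_of_eq:
  assumes "G \<in> carrier_mat n N"
  shows "code_of G = {vec N (\<lambda>j. col G j \<bullet> y) | y. y \<in> carrier_vec n}"
proof -
  have "G\<^sup>T *\<^sub>v y = vec N (\<lambda>j. col G j \<bullet> y)" for y
    using assms by (intro eq_vecI) auto
  moreover have "vec N (\<lambda>j. col G j \<bullet> y) \<in> carrier_vec (dim_col G)" for y
    using assms by simp
  ultimately show ?thesis
    using assms unfolding code_of_def vec_space.row_space_eq[OF carrier_matI[OF refl refl]] by auto
qed

text \<open>If \<open>v\<close> and \<open>w\<close> span the same point, then \<open>w\<close> is a
  multiple of \<open>v\<close>, so a property stable under scaling does not depend on the
  representatives. This removes the choice of \<open>G\<close>.\<close>

lemma all_columns_iff: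
  assumes G: "generator_matrix r {proj_point v | v. v \<in> Z} G" and Z: "Z \<subseteq> carrier_vec (r + 1)"
    and Q: "\<And>c v. v \<in> carrier_vec (r + 1) \<Longrightarrow> Q v \<Longrightarrow> Q (c \<cdot>\<^sub>v v)"
  shows "(\<forall>j<dim_col G. Q (col G j)) \<longleftrightarrow> (\<forall>v\<in>Z. Q v)"
proof -
  have self: "v \<in> proj_point v" for v :: "'a vec"
    unfolding proj_point_def by (auto intro!: exI[of _ 1])
  have transfer: "Q w" if "proj_point v = proj_point w" "v \<in> carrier_vec (r + 1)" "Q v" for v w
    using self[of w] that Q unfolding that(1)[symmetric] by (auto simp: proj_point_def)
  have carrier: "G \<in> carrier_mat (r + 1) (card {proj_point v | v. v \<in> Z})"
    and bij: "bij_betw (\<lambda>j. proj_point (col G j)) {..<card {proj_point v | v. v \<in> Z}} {proj_point v | v. v \<in> Z}"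
    using G by (auto simp: generator_matrix_def)
  have N: "card {proj_point v | v. v \<in> Z} = dim_col G"
    using carrier_matD(2)[OF carrier] by simp
  have col: "col G j \<in> carrier_vec (r + 1)" for j
    using carrier_matD(1)[OF carrier] by (intro carrier_vecI) simp
  have image: "(\<lambda>j. proj_point (col G j)) ` {..<dim_col G} = {proj_point v | v. v \<in> Z}"
    using bij unfolding N by (rule bij_betw_imp_surj_on)
  show ?thesis
  proof (intro iffI ballI allI impI)
    fix v assume cols: "\<forall>j<dim_col G. Q (col G j)" and "v \<in> Z"
    then have "proj_point v \<in> (\<lambda>j. proj_point (col G j)) ` {..<dim_col G}"
      unfolding image by blast
    then obtain j where "j < dim_col G" "proj_point (col G j) = proj_point v"
      by auto
    then show "Q v"
      using cols col transfer by blast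
  next
    fix j assume points: "\<forall>v\<in>Z. Q v" and "j < dim_col G"
    then have "proj_point (col G j) \<in> {proj_point v | v. v \<in> Z}"
      unfolding image[symmetric] by blast
    then obtain v where "v \<in> Z" "proj_point v = proj_point (col G j)"
      by auto
    then show "Q (col G j)"
      using points Z transfer by blast
  qed
qed

text \<open>A codeword lists the values of a linear form \<open>y\<close> at the points, and its
  support is the complement of the zero set. Inclusion of supports is thus reverse inclusion of zero
  sets on \<open>Z\<close>.\<close>

lemma minimal_code_iff:
  assumes G: "generator_matrix r {proj_point v | v. v \<in> Z} G" and Z: "Z \<subseteq> carrier_vec (r + 1)"
  shows "minimal_code (code_of G) \<longleftrightarrow>
    (\<forall>y\<in>carrier_vec (r + 1). \<forall>y'\<in>carrier_vec (r + 1).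
      (\<exists>v\<in>Z. v \<bullet> y \<noteq> 0) \<longrightarrow> (\<exists>v\<in>Z. v \<bullet> y' \<noteq> 0) \<longrightarrow>
      (\<forall>v\<in>Z. v \<bullet> y = 0 \<longrightarrow> v \<bullet> y' = 0) \<longrightarrow>
      (\<exists>a. \<forall>v\<in>Z. v \<bullet> y' = a * (v \<bullet> y)))"
proof -
  define word where "word y = vec (dim_col G) (\<lambda>j. col G j \<bullet> y)" for y
  have code: "code_of G = word ` carrier_vec (r + 1)"
  proof -
    have "dim_row G = r + 1"
      using G unfolding generator_matrix_def by auto
    then have "G \<in> carrier_mat (r + 1) (dim_col G)"
      by (intro carrier_matI) simp_all
    then show ?thesis
      by (simp only: code_of_eq word_def image_def) blast
  qed
  note all = all_columns_iff[OF G Z]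
  have nonzero: "word y \<noteq> 0\<^sub>v (dim_vec (word y)) \<longleftrightarrow> (\<exists>v\<in>Z. v \<bullet> y \<noteq> 0)"
    if "y \<in> carrier_vec (r + 1)" for y
    using all[of "\<lambda>v. v \<bullet> y = 0"] that by (auto simp: word_def vec_eq_iff)
  have supp: "supp (word y') \<subseteq> supp (word y) \<longleftrightarrow> (\<forall>v\<in>Z. v \<bullet> y = 0 \<longrightarrow> v \<bullet> y' = 0)"
    if "y \<in> carrier_vec (r + 1)" "y' \<in> carrier_vec (r + 1)" for y y'
    using all[of "\<lambda>v. v \<bullet> y = 0 \<longrightarrow> v \<bullet> y' = 0"] that by (auto simp: word_def supp_def)
  have multiple: "word y' = a \<cdot>\<^sub>v word y \<longleftrightarrow> (\<forall>v\<in>Z. v \<bullet> y' = a * (v \<bullet> y))"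
    if "y \<in> carrier_vec (r + 1)" "y' \<in> carrier_vec (r + 1)" for y y' a
    using all[of "\<lambda>v. v \<bullet> y' = a * (v \<bullet> y)"] that by (auto simp: word_def vec_eq_iff mult_ac)
  show ?thesis
    unfolding minimal_code_def minimal_codeword_def code
    by (simp add: nonzero supp multiple imageI imp_conjL cong: ball_cong)
qed

lemma scalar_prod_4:
  fixes v h :: "'a::comm_semiring_0 vec"
  assumes "h \<in> carrier_vec 4"
  shows "v \<bullet> h = h $ 0 * v $ 0 + h $ 1 * v $ 1 + h $ 2 * v $ 2 + h $ 3 * v $ 3"
proof -
  have "{0..<4} = {0, 1, 2, 3 :: nat}" by auto
  then show ?thesis
    using carrier_vecD[OF assms] by (simp add: scalar_prod_def mult.commute add_ac)
qed

section \<open>The criterion applied to the surface\<close>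

context tits_field
begin

lemma minimal_code_V_hyp_iff:
  assumes G: "generator_matrix 3 (V_hyp 3 e \<epsilon>) G"
  shows "minimal_code (code_of G) \<longleftrightarrow> [e = 3] (mod 4)"
proof -
  define Z where "Z = {v \<in> carrier_vec 4. v \<noteq> 0\<^sub>v 4 \<and> meval (\<lambda>i. v $ i) (homogenize (V_poly 3 e \<epsilon>)) = 0}"
  have V: "V_hyp 3 e \<epsilon> = {proj_point v | v. v \<in> Z}"
    by (simp add: V_hyp_def hypersurface_def Z_def)
  have Z_carrier: "Z \<subseteq> carrier_vec (3 + 1)"
    by (auto simp: Z_def)
  note minimal_iff = minimal_code_iff[OF G[unfolded V] Z_carrier]
  define pt :: "'a \<Rightarrow> 'a \<Rightarrow> 'a \<Rightarrow> 'a \<Rightarrow> 'a vec" where "pt w x y z = vec 4 ((!) [w, x, y, z])" for w x y z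
  have pt_carrier: "pt w x y z \<in> carrier_vec 4" for w x y z
    by (simp add: pt_def)
  have pt_index: "pt w x y z $ 0 = w" "pt w x y z $ 1 = x" "pt w x y z $ 2 = y" "pt w x y z $ 3 = z" for w x y z
    by (simp_all add: pt_def)
  have on_V_Z: "pt w x y z \<in> Z" if "on_V w x y z" for w x y z
  proof -
    have "pt w x y z \<noteq> 0\<^sub>v 4"
    proof
      assume "pt w x y z = 0\<^sub>v 4"
      then have "w = 0" "x = 0" "y = 0" "z = 0"
        using pt_index[of w x y z] by simp_all
      then show False
        using that by (simp add: on_V_def)
    qed
    moreover have "meval (\<lambda>i. pt w x y z $ i) (homogenize (V_poly 3 e \<epsilon>)) = 0"
      using that hypersurface_affine[of "\<lambda>i. pt w x y z $ i"] hypersurface_infinity[of "\<lambda>i. pt w x y z $ i"]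
      unfolding pt_index on_V_def by blast
    ultimately show ?thesis
      using pt_carrier by (simp add: Z_def)
  qed
  show ?thesis
  proof
    assume minimal: "minimal_code (code_of G)"
    show "[e = 3] (mod 4)"
    proof (rule ccontr)
      assume "\<not> [e = 3] (mod 4)"
      moreover have "e mod 4 = 1 \<or> e mod 4 = 3"
        using odd_e by presburger
      ultimately have e: "[e = 1] (mod 4)"
        by (auto simp: cong_def)
      have line: "v $ 1 = v $ 2" if "v \<in> Z" "v $ 0 = 0" for v
      proof -
        have "meval (\<lambda>i. v $ i) (homogenize (V_poly 3 e \<epsilon>)) = 0"
          using that(1) by (simp add: Z_def)
        then have "v $ 1 ^ (s + 2) = v $ 2 ^ (s + 2)"
          by (simp only: hypersurface_infinity[of "\<lambda>i. v $ i", OF that(2)])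
        then show ?thesis
          by (rule power_s_plus_2_inj[OF e])
      qed
      obtain z where "tr z = Gamma_val e \<epsilon> 1 + Gamma_val e \<epsilon> 0"
        by (rule exists_affine_over)
      then have "on_V 1 1 0 z"
        by (simp add: on_V_def)
      then have point: "pt 1 1 0 z \<in> Z"
        by (rule on_V_Z)
      have "on_V 1 0 0 0"
        by (simp add: on_V_def Gamma_val_0 tr_in q_def)
      then have origin: "pt 1 0 0 0 \<in> Z"
        by (rule on_V_Z)
      \<comment> \<open>The forms \<open>X0\<close> and \<open>X1 + X2\<close>: the second vanishes
        on the whole section at infinity but is not a multiple of the first on
        \<open>Z\<close>.\<close>
      define h where "h = pt 1 0 0 0"
      define l where "l = pt 0 1 1 0"
      have dot_hl: "v \<bullet> h = v $ 0" "v \<bullet> l = v $ 1 + v $ 2" for v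
        by (simp_all add: h_def l_def scalar_prod_4[OF pt_carrier] pt_index del: One_nat_def)
      have "h \<in> carrier_vec (3 + 1)" "l \<in> carrier_vec (3 + 1)"
        using pt_carrier by (simp_all add: h_def l_def)
      moreover have "\<exists>v\<in>Z. v \<bullet> h \<noteq> 0" "\<exists>v\<in>Z. v \<bullet> l \<noteq> 0"
        by (rule bexI[OF _ point], simp add: dot_hl pt_index del: One_nat_def)+
      moreover have "\<forall>v\<in>Z. v \<bullet> h = 0 \<longrightarrow> v \<bullet> l = 0"
        using line by (simp add: dot_hl)
      ultimately obtain k where "\<forall>v\<in>Z. v \<bullet> l = k * (v \<bullet> h)"
        using minimal unfolding minimal_iff by blast
      then have "\<forall>v\<in>Z. v $ 1 + v $ 2 = k * v $ 0"
        by (simp add: dot_hl)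
      \<comment> \<open>The first point gives \<open>k = 1\<close>, the origin gives
        \<open>k = 0\<close>.\<close>
      from bspec[OF this point] bspec[OF this origin] show False
        unfolding pt_index by simp
    qed
  next
    assume e: "[e = 3] (mod 4)"
    show "minimal_code (code_of G)"
      unfolding minimal_iff
    proof (intro ballI impI)
      fix h h' assume h: "h \<in> carrier_vec (3 + 1)" "h' \<in> carrier_vec (3 + 1)"
        and nz: "\<exists>v\<in>Z. v \<bullet> h \<noteq> 0" and sub: "\<forall>v\<in>Z. v \<bullet> h = 0 \<longrightarrow> v \<bullet> h' = 0"
      have dot: "v \<bullet> h = h $ 0 * v $ 0 + h $ 1 * v $ 1 + h $ 2 * v $ 2 + h $ 3 * v $ 3"
        "v \<bullet> h' = h' $ 0 * v $ 0 + h' $ 1 * v $ 1 + h' $ 2 * v $ 2 + h' $ 3 * v $ 3" for v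
        using h by (simp_all add: scalar_prod_4)
      have "h' $ 0 * w + h' $ 1 * x + h' $ 2 * y + h' $ 3 * z = 0"
        if "on_V w x y z" "h $ 0 * w + h $ 1 * x + h $ 2 * y + h $ 3 * z = 0" for w x y z
        using bspec[OF sub on_V_Z[OF that(1)]] that(2) unfolding dot pt_index by blast
      moreover have "(h $ 0, h $ 1, h $ 2, h $ 3) \<noteq> (0, 0, 0, 0)"
        using nz by (auto simp: dot)
      ultimately obtain k where "h' $ 0 = k * h $ 0" "h' $ 1 = k * h $ 1" "h' $ 2 = k * h $ 2" "h' $ 3 = k * h $ 3"
        using plane_section_spans[OF e] by blast
      then have "\<forall>v\<in>Z. v \<bullet> h' = k * (v \<bullet> h)"
        unfolding dot by (simp add: distrib_left mult.assoc)
      then show "\<exists>k. \<forall>v\<in>Z. v \<bullet> h' = k * (v \<bullet> h)" ..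
    qed
  qed
qed

end

theorem theorem3p5:
  fixes e :: nat and \<epsilon> \<delta> :: "'a::{field,finite}" and G :: "'a mat"
  assumes "e \<ge> 3" and "odd e"
    and "card (UNIV :: 'a set) = (2 ^ e) ^ 2"
    and "\<epsilon> ^ (2 ^ e) \<noteq> \<epsilon>"
    and "\<delta> ^ (2 ^ e) = \<delta>" and "\<delta> \<noteq> 1"
    and "(\<Sum>i<e. \<delta> ^ (2 ^ i)) = 1"
    and "\<epsilon>\<^sup>2 + \<epsilon> + \<delta> = 0"
    and "generator_matrix 3 (V_hyp 3 e \<epsilon>) G"
  shows "minimal_code (code_of G) \<longleftrightarrow> [e = 3] (mod 4)"
proof -
  interpret tits_field e \<epsilon> \<delta>
    by standard (use assms in auto)
  show ?thesis
    using assms(9) by (rule minimal_code_V_hyp_iff)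
qed

end
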